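(* Consider the orthodisjunctive problem (ODP): $\min_x f(x)$ s.t. $F(x)\in\Gamma:=\bigcup_{j=1}^t\Gamma_j$ with $\Gamma_j:=\prod_{i=1}^\ell[a_i^j,b_i^j]$, where $-\infty\le a_i^j\le b_i^j\le\infty$, $f\colon\mathbb{R}^n\to\mathbb{R}$ is continuously differentiable, and $F\colon\mathbb{R}^n\to\mathbb{R}^\ell$ is directionally differentiable and locally Lipschitz continuous. Assume that for all $x,d\in\mathbb{R}^n$ and $\lambda\in\mathbb{R}^\ell$, \[ \partial\langle\lambda,F\rangle(x;d)=\sum_{i=1}^\ell|\lambda_i|\,\partial(\operatorname{sgn}(\lambda_i)F_i)(x;d). \] Let $\bar x\in\mathbb{R}^n$ be an AM-stationary point of (ODP). (a) If ODP-subMFC is satisfied at $\bar x$, then $\bar x$ is M-stationary. (b) Fix $d\in C(\bar x)\cap\mathbb{S}$. If ODP-subMFC$(d)$ is satisfied at $\bar x$, then $\bar x$ is M-stationary in direction $d$.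
   Context: Notation. $\|\cdot\|$ is the Euclidean norm, $\mathbb{S}$ the unit sphere, $\operatorname{sgn}\colon\mathbb{R}\to\{-1,0,1\}$ the sign function. Intervals: $[-\infty,r]:=(-\infty,r]$, $[r,\infty]:=[r,\infty)$, $[-\infty,\infty]:=\mathbb{R}$ for $r\in\mathbb{R}$. For a closed set $\Omega\subseteq\mathbb{R}^m$, $z\in\Omega$, $w\in\mathbb{R}^m$: $T_\Omega(z)=\{v : \exists v^k\to v,\ t_k\downarrow 0,\ z+t_kv^k\in\Omega\ \forall k\}$; $\widehat N_\Omega(z)=\{\eta : \eta^\top v\le 0\ \forall v\in T_\Omega(z)\}$; $N_\Omega(z)=\{\eta : \exists z^k\to z,\ z^k\in\Omega,\ \eta^k\to\eta,\ \eta^k\in\widehat N_\Omega(z^k)\ \forall k\}$; $N_\Omega(z;w)=\{\eta : \exists w^k\to w,\ t_k\downarrow0,\ \eta^k\to\eta,\ \eta^k\in\widehat N_\Omega(z+t_kw^k)\ \forall k\}$. All are empty if $z\notin\Omega$. For a directionally differentiable, locally Lipschitz $\varphi\colon\mathbb{R}^n\to\mathbb{R}$: $\partial\varphi(x;d)=\{\xi : (\xi,-1)\in N_{\operatorname{epi}\varphi}((x,\varphi(x));(d,\varphi'(x;d)))\}$ and $\partial\varphi(x)=\partial\varphi(x;0)=\{\xi:(\xi,-1)\in N_{\operatorname{epi}\varphi}((x,\varphi(x)))\}$, where $\varphi'(x;d)$ is the directional derivative and $\operatorname{epi}\varphi=\{(x,\alpha):\varphi(x)\le\alpha\}$. $\langle\lambda,F\rangle(x)=\lambda^\top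 F(x)$. For vectors $v^k$ and $\alpha_k\ge0$, $v^k\in o(\alpha_k)$ means $\|v^k\|\le\alpha_k\epsilon_k$ for all $k$ with some null sequence $\epsilon_k\ge0$. Linearization cone: $T^{\rm lin}_{F,\Gamma}(\bar x)=\{d : F'(\bar x;d)\in T_\Gamma(F(\bar x))\}$. Explicit critical cone: $C(\bar x)=\{d : f'(\bar x)d\le0,\ d\in T^{\rm lin}_{F,\Gamma}(\bar x)\}$. A feasible point $\bar x$ is M-stationary if there is $\lambda\in\mathbb{R}^\ell$ with $-\nabla f(\bar x)\in\partial\langle\lambda,F\rangle(\bar x)$ and $\lambda\in N_\Gamma(F(\bar x))$. For $d\in C(\bar x)$ it is M-stationary in direction $d$ if there is $\lambda$ with $-\nabla f(\bar x)\in\partial\langle\lambda,F\rangle(\bar x;d)$ and $\lambda\in N_\Gamma(F(\bar x);F'(\bar x;d))$. AM-stationary sequence w.r.t. a feasible $\bar x$: $\{(x^k,\lambda^k,\delta^k,\varepsilon^k)\}\subseteq\mathbb{R}^{n+\ell+\ell+n}$ with $\varepsilon^k-\nabla f(x^k)\in\partial\langle\lambda^k,F\rangle(x^k)$, $\lambda^k\in N_\Gamma(F(x^k)-\delta^k)$ for all $k$, and $(x^k,\delta^k,\varepsilon^k)\to(\bar x,0,0)$. If one exists, $\bar x$ is AM-stationary. For $d\in T^{\rm lin}_{F,\Gamma}(\bar x)\cap\mathbb{S}$, the sequence is AM-stationary w.r.t. $\bar x$ in direction $d$ if additionally $x^k\ne\bar x$ for all $k$, $(x^k-\bar x)/\|x^k-\bar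 x\|\to d$, $\delta^k/\|x^k-\bar x\|\to0$, $\|\delta^k\|\lambda^k-\|\lambda^k\|\delta^k\in o(\|\delta^k\|\|\lambda^k\|)$, and $\{\|\delta^k\|\|\lambda^k\|/\|x^k-\bar x\|\}_k$ is bounded. Index sets: if $F(x)-\delta\in\Gamma$, let $J(x,\delta)=\{j : F(x)-\delta\in\Gamma_j\}$ and $I(x,\delta)=\{i\in\{1,\dots,\ell\} : \exists j\in J(x,\delta),\ F_i(x)-\delta_i\in\{a_i^j,b_i^j\}\}$; $I(\bar x)=I(\bar x,0)$ for feasible $\bar x$. ODP-subMFC holds at an AM-stationary point $\bar x$ if there exist $I\subseteq I(\bar x)$ and a sequence $\{(x^k,\lambda^k,\delta^k,\varepsilon^k)\}_{k=1}^\infty\subseteq\mathbb{R}^{n+\ell+\ell+n}$ such that (i) either $I=\emptyset$, or for all $u\in\mathbb{R}^\ell\setminus\{0\}$ with $u\ge0$ and $u_i=0$ for $i\notin I$ one has $0\notin\sum_{i\in I}u_i\,\partial(\operatorname{sgn}(\lambda_i^k)F_i)(\bar x)$ for all $k\in\mathbb{N}$; (ii) the sequence is AM-stationary w.r.t. $\bar x$ and $I=I(x^k,\delta^k)$ for all $k\in\mathbb{N}$. For $d\in C(\bar x)\cap\mathbb{S}$, ODP-subMFC$(d)$ holds at an AM-stationary point $\bar x$ if there exist $I\subseteq I(\bar x)$ and a sequence $\{(x^k,\lambda^k,\delta^k,\varepsilon^k)\}_{k=1}^\infty\subseteq\mathbb{R}^{n+\ell+\ell+n}$ such that (i) either $I=\emptyset$,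 or for all $u\in\mathbb{R}^\ell\setminus\{0\}$ with $u\ge0$ and $u_i=0$ for $i\notin I$ one has $0\notin\sum_{i\in I}u_i\,\partial(\operatorname{sgn}(\lambda_i^k)F_i)(\bar x;d)$ for all $k\in\mathbb{N}$; (ii) the sequence is AM-stationary w.r.t. $\bar x$ in direction $d$ and $I=I(x^k,\delta^k)$ for all $k\in\mathbb{N}$. *)

theory Defs
  imports "HOL-Analysis.Analysis" "HOL-Library.Set_Algebras"
begin

text \<open>As usual, \<open>t\<^sub>k \<down> 0\<close> means \<open>t\<^sub>k > 0\<close> and \<open>t\<^sub>k \<rightarrow> 0\<close>. All cones are empty at points
  outside of the set.\<close>

definition tangent_cone :: "'a::euclidean_space set \<Rightarrow> 'a \<Rightarrow> 'a set" where
  "tangent_cone \<Omega> z = {v. z \<in> \<Omega> \<and>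
     (\<exists>vs t. vs \<longlonglongrightarrow> v \<and> t \<longlonglongrightarrow> (0::real) \<and> (\<forall>k. t k > 0) \<and> (\<forall>k. z + t k *\<^sub>R vs k \<in> \<Omega>))}"

definition regular_normal_cone :: "'a::euclidean_space set \<Rightarrow> 'a \<Rightarrow> 'a set" where
  "regular_normal_cone \<Omega> z = {\<eta>. z \<in> \<Omega> \<and> (\<forall>v \<in> tangent_cone \<Omega> z. \<eta> \<bullet> v \<le> 0)}"

definition normal_cone :: "'a::euclidean_space set \<Rightarrow> 'a \<Rightarrow> 'a set" where
  "normal_cone \<Omega> z = {\<eta>. z \<in> \<Omega> \<and>
     (\<exists>zs \<eta>s. zs \<longlonglongrightarrow> z \<and> (\<forall>k. zs k \<in> \<Omega>) \<and> \<eta>s \<longlonglongrightarrow> \<eta> \<and>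
        (\<forall>k. \<eta>s k \<in> regular_normal_cone \<Omega> (zs k)))}"

definition dir_normal_cone :: "'a::euclidean_space set \<Rightarrow> 'a \<Rightarrow> 'a \<Rightarrow> 'a set" where
  "dir_normal_cone \<Omega> z w = {\<eta>. z \<in> \<Omega> \<and>
     (\<exists>ws t \<eta>s. ws \<longlonglongrightarrow> w \<and> t \<longlonglongrightarrow> (0::real) \<and> (\<forall>k. t k > 0) \<and> \<eta>s \<longlonglongrightarrow> \<eta> \<and>
        (\<forall>k. \<eta>s k \<in> regular_normal_cone \<Omega> (z + t k *\<^sub>R ws k)))}"

definition directionally_differentiable ::
    "('a::real_normed_vector \<Rightarrow> 'b::real_normed_vector) \<Rightarrow> bool" where
  "directionally_differentiable \<phi> \<longleftrightarrow>
     (\<forall>x d. \<exists>l. ((\<lambda>t. (\<phi> (x + t *\<^sub>R d) - \<phi> x) /\<^sub>R t) \<longlongrightarrow> l) (at_right 0))"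

definition dir_deriv ::
    "('a::real_normed_vector \<Rightarrow> 'b::real_normed_vector) \<Rightarrow> 'a \<Rightarrow> 'a \<Rightarrow> 'b" where
  "dir_deriv \<phi> x d = Lim (at_right 0) (\<lambda>t. (\<phi> (x + t *\<^sub>R d) - \<phi> x) /\<^sub>R t)"

definition locally_lipschitz :: "('a::metric_space \<Rightarrow> 'b::metric_space) \<Rightarrow> bool" where
  "locally_lipschitz \<phi> \<longleftrightarrow> (\<forall>x. \<exists>e>0. \<exists>L. L-lipschitz_on (ball x e) \<phi>)"

definition grad :: "('a::euclidean_space \<Rightarrow> real) \<Rightarrow> 'a \<Rightarrow> 'a" where
  "grad f x = (THE D. GDERIV f x :> D)"

lemma grad_eq:
  assumes "GDERIV f x :> D"
  shows "grad f x = D"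
proof -
  have "D' = D" if "GDERIV f x :> D'" for D'
    using has_derivative_unique[OF that[unfolded gderiv_def] assms[unfolded gderiv_def]]
    by (metis inner_commute vector_eq_rdot)
  then show ?thesis
    using assms unfolding grad_def by blast
qed

lemma has_derivative_grad:
  fixes f :: "'a::euclidean_space \<Rightarrow> real"
  assumes "f differentiable (at x)"
  shows "(f has_derivative (\<lambda>d. grad f x \<bullet> d)) (at x)"
proof -
  from assms obtain f' where f': "(f has_derivative f') (at x)"
    unfolding differentiable_def by blast
  have "f' = (\<lambda>h. h \<bullet> adjoint f' 1)"
    using adjoint_works[OF has_derivative_linear[OF f'], of _ 1]
    by (auto simp: fun_eq_iff)
  then have D: "GDERIV f x :> adjoint f' 1"
    using f' by (simp add: gderiv_def)
  have "GDERIV f x :> grad f x"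
    using D grad_eq[OF D] by simp
  then show ?thesis
    by (simp add: gderiv_def inner_commute)
qed

definition cont_differentiable :: "('a::euclidean_space \<Rightarrow> real) \<Rightarrow> bool" where
  "cont_differentiable f \<longleftrightarrow> (\<forall>x. f differentiable (at x)) \<and> continuous_on UNIV (grad f)"

definition subdiff :: "('a::euclidean_space \<Rightarrow> real) \<Rightarrow> 'a \<Rightarrow> 'a set" where
  "subdiff \<phi> x = {\<xi>. (\<xi>, -1) \<in> normal_cone (epigraph UNIV \<phi>) (x, \<phi> x)}"

definition dir_subdiff :: "('a::euclidean_space \<Rightarrow> real) \<Rightarrow> 'a \<Rightarrow> 'a \<Rightarrow> 'a set" where
  "dir_subdiff \<phi> x d =
     {\<xi>. (\<xi>, -1) \<in> dir_normal_cone (epigraph UNIV \<phi>) (x, \<phi> x) (d, dir_deriv \<phi> x d)}"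

lemma dir_normal_cone_0: "dir_normal_cone \<Omega> z 0 = normal_cone \<Omega> z"
proof (intro equalityI subsetI)
  fix \<eta> assume "\<eta> \<in> dir_normal_cone \<Omega> z 0"
  then obtain ws t \<eta>s where z: "z \<in> \<Omega>" and ws: "ws \<longlonglongrightarrow> 0" and t: "t \<longlonglongrightarrow> (0::real)"
    and \<eta>s: "\<eta>s \<longlonglongrightarrow> \<eta>" "\<And>k. \<eta>s k \<in> regular_normal_cone \<Omega> (z + t k *\<^sub>R ws k)"
    by (auto simp: dir_normal_cone_def)
  define zs where "zs k = z + t k *\<^sub>R ws k" for k
  have "zs \<longlonglongrightarrow> z + 0 *\<^sub>R 0"
    unfolding zs_def by (intro tendsto_intros t ws)
  then have "zs \<longlonglongrightarrow> z" by simp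
  moreover have "\<forall>k. zs k \<in> \<Omega>" "\<forall>k. \<eta>s k \<in> regular_normal_cone \<Omega> (zs k)"
    using \<eta>s(2) by (simp_all add: zs_def regular_normal_cone_def)
  ultimately show "\<eta> \<in> normal_cone \<Omega> z"
    unfolding normal_cone_def using z \<eta>s(1) by blast
next
  fix \<eta> assume "\<eta> \<in> normal_cone \<Omega> z"
  then obtain zs \<eta>s where z: "z \<in> \<Omega>" and zs: "zs \<longlonglongrightarrow> z"
    and \<eta>s: "\<eta>s \<longlonglongrightarrow> \<eta>" "\<And>k. \<eta>s k \<in> regular_normal_cone \<Omega> (zs k)"
    by (auto simp: normal_cone_def)
  define t where "t k = sqrt (norm (zs k - z)) + inverse (real (Suc k))" for k
  define ws where "ws k = (zs k - z) /\<^sub>R t k" for k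
  have lim: "(\<lambda>k. norm (zs k - z)) \<longlonglongrightarrow> 0"
    using zs by (simp add: LIM_zero tendsto_norm_zero)
  have sq: "(\<lambda>k. sqrt (norm (zs k - z))) \<longlonglongrightarrow> 0"
    using tendsto_real_sqrt[OF lim] by simp
  have t: "t \<longlonglongrightarrow> 0"
    unfolding t_def using tendsto_add[OF sq LIMSEQ_inverse_real_of_nat] by simp
  have pos: "t k > 0" for k
    unfolding t_def by (intro add_nonneg_pos) auto
  have "norm (ws k) \<le> sqrt (norm (zs k - z))" for k
  proof -
    have "norm (zs k - z) = sqrt (norm (zs k - z)) * sqrt (norm (zs k - z))"
      by simp
    also have "\<dots> \<le> sqrt (norm (zs k - z)) * t k"
      unfolding t_def by (intro mult_left_mono) auto
    finally show ?thesis
      using pos[of k] by (simp add: ws_def divide_simps mult.commute)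
  qed
  then have ws: "ws \<longlonglongrightarrow> 0"
    by (intro Lim_null_comparison[OF _ sq]) auto
  have "z + t k *\<^sub>R ws k = zs k" for k
    using pos[of k] by (simp add: ws_def)
  then have "\<forall>k. \<eta>s k \<in> regular_normal_cone \<Omega> (z + t k *\<^sub>R ws k)"
    using \<eta>s(2) by simp
  then show "\<eta> \<in> dir_normal_cone \<Omega> z 0"
    unfolding dir_normal_cone_def using z ws t pos \<eta>s(1) by blast
qed

lemma dir_deriv_0: "dir_deriv \<phi> x 0 = 0"
  unfolding dir_deriv_def by (intro tendsto_Lim) auto

lemma dir_subdiff_0: "dir_subdiff \<phi> x 0 = subdiff \<phi> x"
  using dir_normal_cone_0[of "epigraph UNIV \<phi>" "(x, \<phi> x)"]
  by (simp add: dir_subdiff_def subdiff_def dir_deriv_0 zero_prod_def)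

definition scalarize :: "'c::real_inner \<Rightarrow> ('a \<Rightarrow> 'c) \<Rightarrow> 'a \<Rightarrow> real" where
  "scalarize lam F = (\<lambda>x. lam \<bullet> F x)"

text \<open>The function \<open>sgn(s) F\<^sub>i\<close>; for \<open>s = 0\<close> it is the zero function.\<close>

definition sgn_comp :: "real \<Rightarrow> ('a \<Rightarrow> real ^ 'l) \<Rightarrow> 'l::finite \<Rightarrow> 'a \<Rightarrow> real" where
  "sgn_comp s F i = (\<lambda>x. sgn s * F x $ i)"

text \<open>Sums of such sets are the Minkowski sums of theory \<open>Set_Algebras\<close>;
  note \<open>0 \<cdot> \<emptyset> = \<emptyset>\<close>.\<close>

definition set_scale :: "real \<Rightarrow> 'a::real_vector set \<Rightarrow> 'a set" where
  "set_scale c S = (\<lambda>\<xi>. c *\<^sub>R \<xi>) ` S"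

text \<open>\<open>v\<^sup>k \<in> o(\<alpha>\<^sub>k)\<close>: in contrast to the Landau symbol of the library, the estimate is required
  for all indices, not just eventually.\<close>

definition in_small_o :: "(nat \<Rightarrow> 'a::real_normed_vector) \<Rightarrow> (nat \<Rightarrow> real) \<Rightarrow> bool" where
  "in_small_o v \<alpha> \<longleftrightarrow>
     (\<exists>\<epsilon>. (\<forall>k. \<epsilon> k \<ge> 0) \<and> \<epsilon> \<longlonglongrightarrow> 0 \<and> (\<forall>k. norm (v k) \<le> \<alpha> k * \<epsilon> k))"

text \<open>The bounds are extended reals, but the interval \<open>[a\<^sub>i\<^sup>j, b\<^sub>i\<^sup>j]\<close> consists of real numbers only.\<close>

definition box_set :: "('l \<Rightarrow> ereal) \<Rightarrow> ('l \<Rightarrow> ereal) \<Rightarrow> (real ^ 'l::finite) set" where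
  "box_set l u = {y. \<forall>i. l i \<le> ereal (y $ i) \<and> ereal (y $ i) \<le> u i}"

definition odp_set ::
    "nat \<Rightarrow> (nat \<Rightarrow> 'l \<Rightarrow> ereal) \<Rightarrow> (nat \<Rightarrow> 'l \<Rightarrow> ereal) \<Rightarrow> (real ^ 'l::finite) set" where
  "odp_set t a b = (\<Union>j\<in>{1..t}. box_set (a j) (b j))"

definition active_boxes ::
    "('a \<Rightarrow> real ^ 'l::finite) \<Rightarrow> nat \<Rightarrow> (nat \<Rightarrow> 'l \<Rightarrow> ereal) \<Rightarrow> (nat \<Rightarrow> 'l \<Rightarrow> ereal) \<Rightarrow>
     'a \<Rightarrow> real ^ 'l \<Rightarrow> nat set" where
  "active_boxes F t a b x \<delta> = {j\<in>{1..t}. F x - \<delta> \<in> box_set (a j) (b j)}"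

text \<open>This is only meaningful for \<open>F(x) - \<delta> \<in> \<Gamma>\<close>; otherwise it is the empty set.\<close>

definition active_indices ::
    "('a \<Rightarrow> real ^ 'l::finite) \<Rightarrow> nat \<Rightarrow> (nat \<Rightarrow> 'l \<Rightarrow> ereal) \<Rightarrow> (nat \<Rightarrow> 'l \<Rightarrow> ereal) \<Rightarrow>
     'a \<Rightarrow> real ^ 'l \<Rightarrow> 'l set" where
  "active_indices F t a b x \<delta> =
     {i. \<exists>j \<in> active_boxes F t a b x \<delta>. ereal (F x $ i - \<delta> $ i) \<in> {a j i, b j i}}"

definition lin_cone ::
    "('a::euclidean_space \<Rightarrow> 'c::euclidean_space) \<Rightarrow> 'c set \<Rightarrow> 'a \<Rightarrow> 'a set" where
  "lin_cone F \<Gamma> x = {d. dir_deriv F x d \<in> tangent_cone \<Gamma> (F x)}"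

definition critical_cone ::
    "('a::euclidean_space \<Rightarrow> real) \<Rightarrow> ('a \<Rightarrow> 'c::euclidean_space) \<Rightarrow> 'c set \<Rightarrow> 'a \<Rightarrow> 'a set" where
  "critical_cone f F \<Gamma> x = {d. grad f x \<bullet> d \<le> 0 \<and> d \<in> lin_cone F \<Gamma> x}"

definition M_stationary ::
    "('a::euclidean_space \<Rightarrow> real) \<Rightarrow> ('a \<Rightarrow> 'c::euclidean_space) \<Rightarrow> 'c set \<Rightarrow> 'a \<Rightarrow> bool" where
  "M_stationary f F \<Gamma> x \<longleftrightarrow> F x \<in> \<Gamma> \<and>
     (\<exists>lam. - grad f x \<in> subdiff (scalarize lam F) x \<and> lam \<in> normal_cone \<Gamma> (F x))"

definition M_stationary_dir ::
    "('a::euclidean_space \<Rightarrow> real) \<Rightarrow> ('a \<Rightarrow> 'c::euclidean_space) \<Rightarrow> 'c set \<Rightarrow> 'a \<Rightarrow> 'a \<Rightarrow> bool" where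
  "M_stationary_dir f F \<Gamma> x d \<longleftrightarrow> F x \<in> \<Gamma> \<and> d \<in> critical_cone f F \<Gamma> x \<and>
     (\<exists>lam. - grad f x \<in> dir_subdiff (scalarize lam F) x d \<and>
          lam \<in> dir_normal_cone \<Gamma> (F x) (dir_deriv F x d))"

definition AM_sequence ::
    "('a::euclidean_space \<Rightarrow> real) \<Rightarrow> ('a \<Rightarrow> 'c::euclidean_space) \<Rightarrow> 'c set \<Rightarrow> 'a \<Rightarrow>
     (nat \<Rightarrow> 'a) \<Rightarrow> (nat \<Rightarrow> 'c) \<Rightarrow> (nat \<Rightarrow> 'c) \<Rightarrow> (nat \<Rightarrow> 'a) \<Rightarrow> bool" where
  "AM_sequence f F \<Gamma> xbar x lam \<delta> \<epsilon> \<longleftrightarrow> F xbar \<in> \<Gamma> \<and>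
     (\<forall>k. \<epsilon> k - grad f (x k) \<in> subdiff (scalarize (lam k) F) (x k)) \<and>
     (\<forall>k. lam k \<in> normal_cone \<Gamma> (F (x k) - \<delta> k)) \<and>
     x \<longlonglongrightarrow> xbar \<and> \<delta> \<longlonglongrightarrow> 0 \<and> \<epsilon> \<longlonglongrightarrow> 0"

definition AM_stationary ::
    "('a::euclidean_space \<Rightarrow> real) \<Rightarrow> ('a \<Rightarrow> 'c::euclidean_space) \<Rightarrow> 'c set \<Rightarrow> 'a \<Rightarrow> bool" where
  "AM_stationary f F \<Gamma> xbar \<longleftrightarrow> (\<exists>x lam \<delta> \<epsilon>. AM_sequence f F \<Gamma> xbar x lam \<delta> \<epsilon>)"

definition AM_sequence_dir ::
    "('a::euclidean_space \<Rightarrow> real) \<Rightarrow> ('a \<Rightarrow> 'c::euclidean_space) \<Rightarrow> 'c set \<Rightarrow> 'a \<Rightarrow> 'a \<Rightarrow>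
     (nat \<Rightarrow> 'a) \<Rightarrow> (nat \<Rightarrow> 'c) \<Rightarrow> (nat \<Rightarrow> 'c) \<Rightarrow> (nat \<Rightarrow> 'a) \<Rightarrow> bool" where
  "AM_sequence_dir f F \<Gamma> xbar d x lam \<delta> \<epsilon> \<longleftrightarrow>
     d \<in> lin_cone F \<Gamma> xbar \<inter> sphere 0 1 \<and>
     AM_sequence f F \<Gamma> xbar x lam \<delta> \<epsilon> \<and>
     (\<forall>k. x k \<noteq> xbar) \<and>
     (\<lambda>k. (x k - xbar) /\<^sub>R norm (x k - xbar)) \<longlonglongrightarrow> d \<and>
     (\<lambda>k. \<delta> k /\<^sub>R norm (x k - xbar)) \<longlonglongrightarrow> 0 \<and>
     in_small_o (\<lambda>k. norm (\<delta> k) *\<^sub>R lam k - norm (lam k) *\<^sub>R \<delta> k) (\<lambda>k. norm (\<delta> k) * norm (lam k)) \<and>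
     bounded (range (\<lambda>k. norm (\<delta> k) * norm (lam k) / norm (x k - xbar)))"

definition ODP_subMFC ::
    "('a::euclidean_space \<Rightarrow> real) \<Rightarrow> ('a \<Rightarrow> real ^ 'l::finite) \<Rightarrow>
     nat \<Rightarrow> (nat \<Rightarrow> 'l \<Rightarrow> ereal) \<Rightarrow> (nat \<Rightarrow> 'l \<Rightarrow> ereal) \<Rightarrow> 'a \<Rightarrow> bool" where
  "ODP_subMFC f F t a b xbar \<longleftrightarrow>
     (\<exists>I x lam \<delta> \<epsilon>. I \<subseteq> active_indices F t a b xbar 0 \<and>
        (I = {} \<or>
         (\<forall>u::real^'l. u \<noteq> 0 \<and> (\<forall>i. u $ i \<ge> 0) \<and> (\<forall>i. i \<notin> I \<longrightarrow> u $ i = 0) \<longrightarrow>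
            (\<forall>k. 0 \<notin> (\<Sum>i\<in>I. set_scale (u $ i) (subdiff (sgn_comp (lam k $ i) F i) xbar))))) \<and>
        AM_sequence f F (odp_set t a b) xbar x lam \<delta> \<epsilon> \<and>
        (\<forall>k. I = active_indices F t a b (x k) (\<delta> k)))"

definition ODP_subMFC_dir ::
    "('a::euclidean_space \<Rightarrow> real) \<Rightarrow> ('a \<Rightarrow> real ^ 'l::finite) \<Rightarrow>
     nat \<Rightarrow> (nat \<Rightarrow> 'l \<Rightarrow> ereal) \<Rightarrow> (nat \<Rightarrow> 'l \<Rightarrow> ereal) \<Rightarrow> 'a \<Rightarrow> 'a \<Rightarrow> bool" where
  "ODP_subMFC_dir f F t a b xbar d \<longleftrightarrow>
     (\<exists>I x lam \<delta> \<epsilon>. I \<subseteq> active_indices F t a b xbar 0 \<and>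
        (I = {} \<or>
         (\<forall>u::real^'l. u \<noteq> 0 \<and> (\<forall>i. u $ i \<ge> 0) \<and> (\<forall>i. i \<notin> I \<longrightarrow> u $ i = 0) \<longrightarrow>
            (\<forall>k. 0 \<notin> (\<Sum>i\<in>I. set_scale (u $ i) (dir_subdiff (sgn_comp (lam k $ i) F i) xbar d))))) \<and>
        AM_sequence_dir f F (odp_set t a b) xbar d x lam \<delta> \<epsilon> \<and>
        (\<forall>k. I = active_indices F t a b (x k) (\<delta> k)))"

end

theory Submission
  imports Defs
begin

text \<open>The subgradients in an AM-stationary sequence are bounded by the local Lipschitz constant of
  \<open>F\<close>, so after division by \<open>max(1, \<parallel>\<lambda>\<^sup>k\<parallel>)\<close> all data converge along a subsequence with constant signs
  of \<open>\<lambda>\<^sup>k\<close>. If \<open>\<lambda>\<^sup>k\<close> is unbounded, the limit violates the qualification condition; otherwise it is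
  an M-stationarity multiplier. The case (a) is the direction \<open>d = 0\<close> of case (b):
  in place of \<open>\<parallel>x\<^sup>k - x\<parallel>\<close> one uses step sizes to which both \<open>x\<^sup>k - x\<close> and \<open>\<delta>\<^sup>k\<close> are negligible.\<close>

section \<open>Tangents, limits of normals, and step sizes\<close>

lemma tangent_coneI_at_right:
  assumes z: "z \<in> \<Omega>" and ev: "eventually (\<lambda>s. z + s *\<^sub>R v \<in> \<Omega>) (at_right (0::real))"
  shows "v \<in> tangent_cone \<Omega> z"
proof -
  obtain e where e: "e > 0" "\<And>s. 0 < s \<Longrightarrow> s < e \<Longrightarrow> z + s *\<^sub>R v \<in> \<Omega>"
    using ev unfolding eventually_at_right_field by auto
  define t where "t k = e / 2 * inverse (real (Suc k))" for k
  have "t \<longlonglongrightarrow> e / 2 * 0"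
    unfolding t_def by (intro tendsto_intros LIMSEQ_inverse_real_of_nat)
  then have "t \<longlonglongrightarrow> 0" by simp
  moreover have pos: "t k > 0" for k
    using e(1) by (simp add: t_def)
  moreover have "t k < e" for k
  proof -
    have "t k \<le> e / 2 * 1"
      unfolding t_def using e(1) by (intro mult_left_mono) (auto simp: field_simps)
    with e(1) show ?thesis by simp
  qed
  ultimately show ?thesis
    unfolding tangent_cone_def using z e(2) by (auto intro!: exI[of _ "\<lambda>_. v"] exI[of _ t])
qed

text \<open>A diagonal argument: each limiting normal at \<open>zs k\<close> is replaced by a
  regular normal at a point so close by that the difference quotients keep their limit
  \<open>w\<close>.\<close>

lemma dir_normal_coneI:
  assumes z: "z \<in> \<Omega>" and t: "t \<longlonglongrightarrow> 0" "\<And>k. t k > 0"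
    and zs: "(\<lambda>k. (zs k - z) /\<^sub>R t k) \<longlonglongrightarrow> w"
    and eta: "\<eta>s \<longlonglongrightarrow> \<eta>" "\<And>k. \<eta>s k \<in> normal_cone \<Omega> (zs k)"
  shows "\<eta> \<in> dir_normal_cone \<Omega> z w"
proof -
  \<comment> \<open>The factor \<open>t k\<close> in the first tolerance makes the error vanish even
    after division by \<open>t k\<close>.\<close>
  have "\<exists>y \<theta>. \<theta> \<in> regular_normal_cone \<Omega> y \<and> norm (y - zs k) \<le> t k * inverse (real (Suc k))
          \<and> norm (\<theta> - \<eta>s k) \<le> inverse (real (Suc k))" for k
  proof -
    obtain ys \<theta>s where ys: "ys \<longlonglongrightarrow> zs k" "\<theta>s \<longlonglongrightarrow> \<eta>s k"
      "\<And>m. \<theta>s m \<in> regular_normal_cone \<Omega> (ys m)"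
      using eta(2)[of k] by (auto simp: normal_cone_def)
    have "\<forall>\<^sub>F m in sequentially. dist (ys m) (zs k) < t k * inverse (real (Suc k))"
      by (rule tendstoD[OF ys(1)]) (use t(2) in simp)
    moreover have "\<forall>\<^sub>F m in sequentially. dist (\<theta>s m) (\<eta>s k) < inverse (real (Suc k))"
      by (rule tendstoD[OF ys(2)]) simp
    ultimately have "\<forall>\<^sub>F m in sequentially. dist (ys m) (zs k) < t k * inverse (real (Suc k))
        \<and> dist (\<theta>s m) (\<eta>s k) < inverse (real (Suc k))"
      by (rule eventually_conj)
    then obtain m where "dist (ys m) (zs k) < t k * inverse (real (Suc k))"
        "dist (\<theta>s m) (\<eta>s k) < inverse (real (Suc k))"
      using eventually_happens'[OF sequentially_bot] by blast
    then show ?thesis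
      using ys(3)[of m] by (metis dist_norm less_imp_le)
  qed
  then obtain y \<theta> where y: "\<And>k. \<theta> k \<in> regular_normal_cone \<Omega> (y k)"
      "\<And>k. norm (y k - zs k) \<le> t k * inverse (real (Suc k))"
      "\<And>k. norm (\<theta> k - \<eta>s k) \<le> inverse (real (Suc k))"
    by metis
  define ws where "ws k = (y k - z) /\<^sub>R t k" for k
  have "(\<lambda>k. (y k - zs k) /\<^sub>R t k) \<longlonglongrightarrow> 0"
  proof (rule Lim_null_comparison[OF _ LIMSEQ_inverse_real_of_nat], intro always_eventually allI)
    fix k
    show "norm ((y k - zs k) /\<^sub>R t k) \<le> inverse (real (Suc k))"
      using y(2)[of k] t(2)[of k] unfolding norm_scaleR by (simp add: field_simps)
  qed
  from tendsto_add[OF this zs] have ws: "ws \<longlonglongrightarrow> w"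
    by (simp add: ws_def[abs_def] flip: scaleR_add_right)
  have "(\<lambda>k. \<theta> k - \<eta>s k) \<longlonglongrightarrow> 0"
    using y(3) by (intro Lim_null_comparison[OF _ LIMSEQ_inverse_real_of_nat]) auto
  from tendsto_add[OF this eta(1)] have th: "\<theta> \<longlonglongrightarrow> \<eta>"
    by simp
  have "z + t k *\<^sub>R ws k = y k" for k
    using t(2)[of k] by (simp add: ws_def)
  then show ?thesis
    unfolding dir_normal_cone_def mem_Collect_eq
    using z ws t th y(1) by (intro conjI exI[of _ ws] exI[of _ t] exI[of _ \<theta>]) auto
qed

text \<open>The square root of the norm tends to zero more slowly than the norm itself; adding
  \<open>1/(k+1)\<close> keeps the step positive where \<open>v k = 0\<close>.\<close>

lemma ex_step_size:
  fixes v :: "nat \<Rightarrow> 'a::real_normed_vector"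
  assumes "v \<longlonglongrightarrow> 0"
  obtains t :: "nat \<Rightarrow> real" where "t \<longlonglongrightarrow> 0" "\<And>k. t k > 0" "(\<lambda>k. v k /\<^sub>R t k) \<longlonglongrightarrow> 0"
proof
  define t where "t k = sqrt (norm (v k)) + inverse (real (Suc k))" for k
  have sq: "(\<lambda>k. sqrt (norm (v k))) \<longlonglongrightarrow> 0"
    using tendsto_real_sqrt[OF tendsto_norm_zero[OF assms]] by simp
  show "t \<longlonglongrightarrow> 0"
    unfolding t_def using tendsto_add[OF sq LIMSEQ_inverse_real_of_nat] by simp
  show pos: "t k > 0" for k
    unfolding t_def by (intro add_nonneg_pos) auto
  have "norm (v k /\<^sub>R t k) \<le> sqrt (norm (v k))" for k
  proof -
    have "norm (v k) = sqrt (norm (v k)) * sqrt (norm (v k))"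
      by simp
    also have "\<dots> \<le> sqrt (norm (v k)) * t k"
      unfolding t_def by (intro mult_left_mono) auto
    finally show ?thesis
      using pos[of k] by (simp add: divide_simps mult.commute)
  qed
  then show "(\<lambda>k. v k /\<^sub>R t k) \<longlonglongrightarrow> 0"
    by (intro Lim_null_comparison[OF _ sq]) auto
qed

section \<open>Directional derivatives and subdifferentials of locally Lipschitz functions\<close>

text \<open>Local Lipschitz continuity lets the direction vary: moving \<open>x k\<close> to the ray
  point \<open>xbar + t k *\<^sub>R d\<close> changes the quotient by at most \<open>L\<close> times
  the distance of \<open>(x k - xbar) /\<^sub>R t k\<close> from \<open>d\<close>.\<close>

lemma difference_quotient_tendsto_dir_deriv:
  fixes \<phi> :: "'a::real_normed_vector \<Rightarrow> 'b::real_normed_vector"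
  assumes dd: "directionally_differentiable \<phi>" and lip: "locally_lipschitz \<phi>"
    and t: "t \<longlonglongrightarrow> 0" "\<And>k. t k > 0"
    and x: "(\<lambda>k. (x k - xbar) /\<^sub>R t k) \<longlonglongrightarrow> d"
  shows "(\<lambda>k. (\<phi> (x k) - \<phi> xbar) /\<^sub>R t k) \<longlonglongrightarrow> dir_deriv \<phi> xbar d"
proof -
  define w where "w k = (x k - xbar) /\<^sub>R t k" for k
  have xw: "x k = xbar + t k *\<^sub>R w k" for k
    using t(2)[of k] by (simp add: w_def)
  have w: "w \<longlonglongrightarrow> d" using x by (simp add: w_def[abs_def])
  obtain l where l: "((\<lambda>s. (\<phi> (xbar + s *\<^sub>R d) - \<phi> xbar) /\<^sub>R s) \<longlongrightarrow> l) (at_right 0)"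
    using dd unfolding directionally_differentiable_def by blast
  have "dir_deriv \<phi> xbar d = l"
    unfolding dir_deriv_def by (rule tendsto_Lim[OF _ l]) simp
  moreover have "filterlim t (at_right 0) sequentially"
    using t by (simp add: filterlim_at less_imp_neq[THEN not_sym])
  ultimately have 1: "(\<lambda>k. (\<phi> (xbar + t k *\<^sub>R d) - \<phi> xbar) /\<^sub>R t k) \<longlonglongrightarrow> dir_deriv \<phi> xbar d"
    using filterlim_compose[OF l] by simp
  obtain e L where e: "e > 0" "L-lipschitz_on (ball xbar e) \<phi>"
    using lip unfolding locally_lipschitz_def by blast
  have "(\<lambda>k. xbar + t k *\<^sub>R w k) \<longlonglongrightarrow> xbar + 0 *\<^sub>R d"
    by (intro tendsto_intros t w)
  then have A: "\<forall>\<^sub>F k in sequentially. xbar + t k *\<^sub>R w k \<in> ball xbar e"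
    using e(1) by (intro topological_tendstoD) auto
  have "(\<lambda>k. xbar + t k *\<^sub>R d) \<longlonglongrightarrow> xbar + 0 *\<^sub>R d"
    by (intro tendsto_intros t w)
  then have B: "\<forall>\<^sub>F k in sequentially. xbar + t k *\<^sub>R d \<in> ball xbar e"
    using e(1) by (intro topological_tendstoD) auto
  have C: "\<forall>\<^sub>F k in sequentially.
      norm ((\<phi> (x k) - \<phi> (xbar + t k *\<^sub>R d)) /\<^sub>R t k) \<le> L * norm (w k - d)"
    using A B
  proof eventually_elim
    case (elim k)
    have "norm (\<phi> (x k) - \<phi> (xbar + t k *\<^sub>R d))
        \<le> L * norm (xbar + t k *\<^sub>R w k - (xbar + t k *\<^sub>R d))"
      using lipschitz_onD[OF e(2) elim] by (simp add: xw dist_norm)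
    also have "\<dots> = t k * (L * norm (w k - d))"
      using t(2)[of k] by (simp flip: scaleR_diff_right)
    finally show ?case
      using t(2)[of k] unfolding norm_scaleR by (simp add: field_simps)
  qed
  have "(\<lambda>k. L * norm (w k - d)) \<longlonglongrightarrow> L * 0"
    by (intro tendsto_intros tendsto_norm_zero LIM_zero w)
  then have "(\<lambda>k. (\<phi> (x k) - \<phi> (xbar + t k *\<^sub>R d)) /\<^sub>R t k) \<longlonglongrightarrow> 0"
    using Lim_null_comparison[OF C] by simp
  from tendsto_add[OF this 1] show ?thesis
    by (simp flip: scaleR_add_right)
qed

text \<open>Closure of normals under directional limits, applied to the epigraph; the vertical part
  of the base points approaches along the directional derivative.\<close>

lemma dir_subdiff_limit:
  fixes \<phi> :: "'a::euclidean_space \<Rightarrow> real"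
  assumes "directionally_differentiable \<phi>" "locally_lipschitz \<phi>"
    and t: "t \<longlonglongrightarrow> 0" "\<And>k. t k > 0"
    and x: "(\<lambda>k. (x k - xbar) /\<^sub>R t k) \<longlonglongrightarrow> d"
    and xi: "\<xi>s \<longlonglongrightarrow> \<xi>" "\<And>k. \<xi>s k \<in> subdiff \<phi> (x k)"
  shows "\<xi> \<in> dir_subdiff \<phi> xbar d"
  unfolding dir_subdiff_def mem_Collect_eq
proof (rule dir_normal_coneI[OF _ t])
  show "(xbar, \<phi> xbar) \<in> epigraph UNIV \<phi>"
    by (simp add: epigraph_def)
  have "(\<lambda>k. ((x k - xbar) /\<^sub>R t k, (\<phi> (x k) - \<phi> xbar) /\<^sub>R t k))
      \<longlonglongrightarrow> (d, dir_deriv \<phi> xbar d)"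
    by (intro tendsto_Pair x difference_quotient_tendsto_dir_deriv assms)
  then show "(\<lambda>k. ((x k, \<phi> (x k)) - (xbar, \<phi> xbar)) /\<^sub>R t k) \<longlonglongrightarrow> (d, dir_deriv \<phi> xbar d)"
    by (simp add: scaleR_prod_def)
  show "(\<lambda>k. (\<xi>s k, -1::real)) \<longlonglongrightarrow> (\<xi>, -1)"
    by (intro tendsto_intros xi)
  show "(\<xi>s k, -1) \<in> normal_cone (epigraph UNIV \<phi>) (x k, \<phi> (x k))" for k
    using xi(2)[of k] by (simp add: subdiff_def)
qed

text \<open>Moving by \<open>s *\<^sub>R \<xi>\<close> raises \<open>\<phi>\<close> by at most
  \<open>s * L * norm \<xi>\<close>, so \<open>(\<xi>, L * norm \<xi>)\<close> is tangent to the
  epigraph. Testing the normal \<open>(\<xi>, -1)\<close> against it bounds the square of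
  \<open>norm \<xi>\<close> by \<open>L * norm \<xi>\<close>.\<close>

lemma subdiff_norm_le:
  fixes \<phi> :: "'a::euclidean_space \<Rightarrow> real"
  assumes U: "open U" "x \<in> U" and lip: "L-lipschitz_on U \<phi>"
    and xi: "\<xi> \<in> subdiff \<phi> x"
  shows "norm \<xi> \<le> L"
proof -
  obtain zs \<eta>s where zs: "zs \<longlonglongrightarrow> (x, \<phi> x)" "\<eta>s \<longlonglongrightarrow> (\<xi>, -1)"
      "\<And>k. zs k \<in> epigraph UNIV \<phi>"
      "\<And>k. \<eta>s k \<in> regular_normal_cone (epigraph UNIV \<phi>) (zs k)"
    using xi by (auto simp: subdiff_def normal_cone_def)
  let ?v = "(\<xi>, L * norm \<xi>)"
  have "(\<lambda>k. fst (zs k)) \<longlonglongrightarrow> x"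
    using tendsto_fst[OF zs(1)] by simp
  then have "\<forall>\<^sub>F k in sequentially. fst (zs k) \<in> U"
    using U by (rule topological_tendstoD)
  \<comment> \<open>The test is made for the approximating regular normals, whose base points are
    eventually above \<open>U\<close>; the inequality then survives the limit.\<close>
  then have "\<forall>\<^sub>F k in sequentially. \<eta>s k \<bullet> ?v \<le> 0"
  proof eventually_elim
    case (elim k)
    have "((\<lambda>s. fst (zs k) + s *\<^sub>R \<xi>) \<longlongrightarrow> fst (zs k) + 0 *\<^sub>R \<xi>) (at_right (0::real))"
      by (intro tendsto_intros)
    then have "\<forall>\<^sub>F s in at_right (0::real). fst (zs k) + s *\<^sub>R \<xi> \<in> U"
      using U(1) elim by (intro topological_tendstoD) auto
    then have "\<forall>\<^sub>F s in at_right (0::real). zs k + s *\<^sub>R ?v \<in> epigraph UNIV \<phi>"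
      using eventually_at_right_less
    proof eventually_elim
      case (elim s)
      have "dist (\<phi> (fst (zs k) + s *\<^sub>R \<xi>)) (\<phi> (fst (zs k)))
          \<le> L * dist (fst (zs k) + s *\<^sub>R \<xi>) (fst (zs k))"
        by (rule lipschitz_onD[OF lip]) (use elim \<open>fst (zs k) \<in> U\<close> in auto)
      then have "\<phi> (fst (zs k) + s *\<^sub>R \<xi>) \<le> \<phi> (fst (zs k)) + s * (L * norm \<xi>)"
        using elim(2) by (simp add: dist_norm abs_le_iff mult.left_commute)
      moreover have "\<phi> (fst (zs k)) \<le> snd (zs k)"
        using zs(3)[of k] by (auto simp: epigraph_def)
      ultimately show ?case
        by (simp add: epigraph_def)
    qed
    then have "?v \<in> tangent_cone (epigraph UNIV \<phi>) (zs k)"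
      using zs(3) by (intro tangent_coneI_at_right)
    then show ?case
      using zs(4)[of k] by (auto simp: regular_normal_cone_def)
  qed
  moreover have "(\<lambda>k. \<eta>s k \<bullet> ?v) \<longlonglongrightarrow> (\<xi>, -1) \<bullet> ?v"
    by (intro tendsto_intros zs)
  ultimately have "(\<xi>, -1) \<bullet> ?v \<le> 0"
    by (intro tendsto_upperbound) auto
  then have "norm \<xi> * norm \<xi> \<le> L * norm \<xi>"
    by (simp add: inner_prod_def flip: power2_norm_eq_inner power2_eq_square)
  then show ?thesis
    using lipschitz_on_nonneg[OF lip] by (cases "\<xi> = 0") auto
qed

text \<open>Needed for vanishing multiplier components: their signed component is the zero function,
  and a zero multiple of a set contains 0 only if the set is nonempty.\<close>

lemma zero_in_dir_subdiff_zero: "0 \<in> dir_subdiff (\<lambda>_. 0) x d"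
proof (rule dir_subdiff_limit)
  define t where "t k = inverse (real (Suc k))" for k
  show t: "t \<longlonglongrightarrow> 0" "\<And>k. t k > 0"
    unfolding t_def by (rule LIMSEQ_inverse_real_of_nat) simp
  show "(\<lambda>k. (x + t k *\<^sub>R d - x) /\<^sub>R t k) \<longlonglongrightarrow> d"
    by (rule Lim_transform_eventually[OF tendsto_const]) (simp add: t_def)
  \<comment> \<open>Tangents to the upper half space point upwards, so \<open>(0, -1)\<close> is a
    regular normal at every boundary point.\<close>
  have "0 \<le> \<beta>" if "(v, \<beta>) \<in> tangent_cone (epigraph UNIV (\<lambda>_::'a. 0::real)) (y, 0)" for v y \<beta>
  proof -
    obtain vs s where vs: "vs \<longlonglongrightarrow> (v, \<beta>)" "\<And>k. s k > (0::real)"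
        "\<And>k. (y, 0) + s k *\<^sub>R vs k \<in> epigraph UNIV (\<lambda>_::'a. 0)"
      using \<open>(v, \<beta>) \<in> _\<close> unfolding tangent_cone_def by auto
    have "0 \<le> snd (vs k)" for k
      using vs(2)[of k] vs(3)[of k] by (auto simp: epigraph_def zero_le_mult_iff)
    then show ?thesis
      using tendsto_lowerbound[OF tendsto_snd[OF vs(1)], of 0] by simp
  qed
  then have "(0, -1) \<in> regular_normal_cone (epigraph UNIV (\<lambda>_::'a. 0::real)) (y, 0)" for y
    by (auto simp: regular_normal_cone_def epigraph_def)
  then have "0 \<in> subdiff (\<lambda>_::'a. 0) y" for y
    unfolding subdiff_def normal_cone_def mem_Collect_eq
    by (intro conjI exI[of _ "\<lambda>_. (y, 0)"] exI[of _ "\<lambda>_. (0, -1)"] allI tendsto_const)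
      (auto simp: epigraph_def)
  then show "(0::'a) \<in> subdiff (\<lambda>_. 0) (x + t k *\<^sub>R d)" for k .
  show "directionally_differentiable (\<lambda>_::'a. 0::real)"
    unfolding directionally_differentiable_def by (auto intro!: exI[of _ 0])
qed (auto simp: locally_lipschitz_def lipschitz_on_def intro!: exI[of _ "1::real"])

section \<open>Signed components of \<open>F\<close>\<close>

lemma lipschitz_on_sgn_comp:
  assumes "L-lipschitz_on U F"
  shows "L-lipschitz_on U (sgn_comp s F i)"
proof (rule lipschitz_onI)
  fix x y assume "x \<in> U" "y \<in> U"
  have "dist (sgn_comp s F i x) (sgn_comp s F i y) = \<bar>sgn s\<bar> * \<bar>(F x - F y) $ i\<bar>"
    by (simp add: sgn_comp_def dist_real_def abs_mult flip: right_diff_distrib)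
  also have "\<dots> \<le> 1 * norm (F x - F y)"
    by (intro mult_mono component_le_norm_cart) (auto simp: sgn_if)
  also have "\<dots> \<le> L * dist x y"
    using lipschitz_onD[OF assms \<open>x \<in> U\<close> \<open>y \<in> U\<close>] by (simp add: dist_norm)
  finally show "dist (sgn_comp s F i x) (sgn_comp s F i y) \<le> L * dist x y" .
qed (rule lipschitz_on_nonneg[OF assms])

lemma directionally_differentiable_sgn_comp:
  assumes "directionally_differentiable F"
  shows "directionally_differentiable (sgn_comp s F i)"
  unfolding directionally_differentiable_def
proof (intro allI)
  fix x d
  obtain l where "((\<lambda>t. (F (x + t *\<^sub>R d) - F x) /\<^sub>R t) \<longlongrightarrow> l) (at_right 0)"
    using assms unfolding directionally_differentiable_def by blast
  then have "((\<lambda>t. sgn s * ((F (x + t *\<^sub>R d) - F x) /\<^sub>R t) $ i) \<longlongrightarrow> sgn s * l $ i) (at_right 0)"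
    by (intro tendsto_intros)
  then show "\<exists>l. ((\<lambda>t. (sgn_comp s F i (x + t *\<^sub>R d) - sgn_comp s F i x) /\<^sub>R t) \<longlongrightarrow> l) (at_right 0)"
    by (intro exI) (simp add: sgn_comp_def algebra_simps)
qed

section \<open>Normals to unions of boxes\<close>

text \<open>A coordinate strictly between its bounds can be moved a little in the direction of
  \<open>\<eta> $ i\<close> without leaving the box. That direction is then tangent, yet its inner
  product with \<open>\<eta>\<close> is the square of \<open>\<eta> $ i\<close>.\<close>

lemma regular_normal_cone_odp_set:
  assumes eta: "\<eta> \<in> regular_normal_cone (odp_set t a b) z"
    and j: "j \<in> {1..t}" "z \<in> box_set (a j) (b j)" and i: "\<eta> $ i \<noteq> 0"
  shows "ereal (z $ i) \<in> {a j i, b j i}"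
proof (rule ccontr)
  assume "ereal (z $ i) \<notin> {a j i, b j i}"
  then have lt: "a j i < ereal (z $ i)" "ereal (z $ i) < b j i"
    using j(2) by (auto simp: box_set_def less_le)
  let ?v = "axis i (\<eta> $ i)"
  have lim: "((\<lambda>s. ereal (z $ i + s * \<eta> $ i)) \<longlongrightarrow> ereal (z $ i + 0 * \<eta> $ i)) (at_right 0)"
    by (intro tendsto_intros)
  have "\<forall>\<^sub>F s in at_right 0. a j i < ereal (z $ i + s * \<eta> $ i)"
       "\<forall>\<^sub>F s in at_right 0. ereal (z $ i + s * \<eta> $ i) < b j i"
    using order_tendstoD[OF lim] lt by auto
  then have "\<forall>\<^sub>F s in at_right 0. z + s *\<^sub>R ?v \<in> odp_set t a b"
  proof eventually_elim
    case (elim s)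
    then have "z + s *\<^sub>R ?v \<in> box_set (a j) (b j)"
      using j(2) by (auto simp: box_set_def axis_def)
    then show ?case using j(1) by (auto simp: odp_set_def)
  qed
  moreover have "z \<in> odp_set t a b"
    using j by (auto simp: odp_set_def)
  ultimately have "\<eta> \<bullet> ?v \<le> 0"
    using eta tangent_coneI_at_right by (auto simp: regular_normal_cone_def)
  then show False
    using i by (auto simp: inner_axis mult_le_0_iff)
qed

lemma closed_box_set: "closed (box_set l u)"
  unfolding box_set_def
  by (intro closed_Collect_all closed_Collect_conj closed_Collect_le continuous_intros
        continuous_on_ereal)

text \<open>A nonzero component stays nonzero for the approximating regular normals, which forces
  their base points onto endpoints; with finitely many boxes this passes to the limit point.\<close>

lemma normal_cone_odp_set_active:
  assumes lam: "lam \<in> normal_cone (odp_set t a b) (F x - \<delta>)" and i: "lam $ i \<noteq> 0"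
  shows "i \<in> active_indices F t a b x \<delta>"
proof -
  obtain zs \<eta>s where zs: "zs \<longlonglongrightarrow> F x - \<delta>" "\<And>k. zs k \<in> odp_set t a b" "\<eta>s \<longlonglongrightarrow> lam"
      "\<And>k. \<eta>s k \<in> regular_normal_cone (odp_set t a b) (zs k)"
    using lam by (auto simp: normal_cone_def)
  \<comment> \<open>The box may change with \<open>k\<close>; a closed set pairing each box with its
    own endpoints keeps the two together in the limit.\<close>
  define U where "U = (\<Union>j\<in>{1..t}. box_set (a j) (b j) \<inter> {y. ereal (y $ i) \<in> {a j i, b j i}})"
  have "closed U"
    unfolding U_def insert_iff empty_iff simp_thms
    by (intro closed_UN ballI closed_Int closed_box_set closed_Collect_disj closed_Collect_eq
          continuous_intros continuous_on_ereal finite_atLeastAtMost)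
  moreover have "\<forall>\<^sub>F k in sequentially. \<eta>s k $ i \<noteq> 0"
    by (rule tendsto_imp_eventually_ne[OF tendsto_vec_nth[OF zs(3)] i])
  then have "\<forall>\<^sub>F k in sequentially. zs k \<in> U"
  proof eventually_elim
    case (elim k)
    obtain j where "j \<in> {1..t}" "zs k \<in> box_set (a j) (b j)"
      using zs(2)[of k] by (auto simp: odp_set_def)
    then show ?case
      using regular_normal_cone_odp_set[OF zs(4) _ _ elim] unfolding U_def by blast
  qed
  ultimately have "F x - \<delta> \<in> U"
    using zs(1) by (intro Lim_in_closed_set) auto
  then show ?thesis
    unfolding U_def active_indices_def active_boxes_def by auto
qed

section \<open>Extraction of a multiplier from an AM-stationary sequence\<close>

text \<open>Serves both claims: \<open>d\<close> may be zero or a unit vector, and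
  \<open>\<tau>\<close> stands for step sizes that are chosen differently in the two cases.\<close>

lemma multiplier_of_subMFC:
  fixes f :: "real ^ 'n \<Rightarrow> real" and F :: "real ^ 'n \<Rightarrow> real ^ 'l"
  assumes f: "cont_differentiable f"
    and F: "directionally_differentiable F" "locally_lipschitz F"
    and sumrule: "\<And>x d lam. dir_subdiff (scalarize lam F) x d =
           (\<Sum>i\<in>UNIV. set_scale \<bar>lam $ i\<bar> (dir_subdiff (sgn_comp (lam $ i) F i) x d))"
    and AM: "AM_sequence f F (odp_set t a b) xbar x lam \<delta> \<epsilon>"
    and I: "\<And>k. I = active_indices F t a b (x k) (\<delta> k)"
    and cq: "I = {} \<or>
         (\<forall>u::real^'l. u \<noteq> 0 \<and> (\<forall>i. u $ i \<ge> 0) \<and> (\<forall>i. i \<notin> I \<longrightarrow> u $ i = 0) \<longrightarrow>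
            (\<forall>k. 0 \<notin> (\<Sum>i\<in>I. set_scale (u $ i) (dir_subdiff (sgn_comp (lam k $ i) F i) xbar d))))"
    and \<tau>: "\<tau> \<longlonglongrightarrow> 0" "\<And>k. \<tau> k > 0"
    and x_dir: "(\<lambda>k. (x k - xbar) /\<^sub>R \<tau> k) \<longlonglongrightarrow> d"
    and \<delta>_dir: "(\<lambda>k. \<delta> k /\<^sub>R \<tau> k) \<longlonglongrightarrow> 0"
  shows "\<exists>mu. - grad f xbar \<in> dir_subdiff (scalarize mu F) xbar d \<and>
           mu \<in> dir_normal_cone (odp_set t a b) (F xbar) (dir_deriv F xbar d)"
proof -
  have feas: "F xbar \<in> odp_set t a b" and x: "x \<longlonglongrightarrow> xbar" and \<epsilon>: "\<epsilon> \<longlonglongrightarrow> 0"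
    and sub: "\<And>k. \<epsilon> k - grad f (x k) \<in> subdiff (scalarize (lam k) F) (x k)"
    and nor: "\<And>k. lam k \<in> normal_cone (odp_set t a b) (F (x k) - \<delta> k)"
    using AM by (auto simp: AM_sequence_def)
  \<comment> \<open>The sum rule in direction 0 splits each subgradient; collecting the parts in one
    vector lets compactness act on all of them at once.\<close>
  have "\<exists>\<xi>::(real^'n)^'l. (\<forall>i. \<xi> $ i \<in> subdiff (sgn_comp (lam k $ i) F i) (x k)) \<and>
      \<epsilon> k - grad f (x k) = (\<Sum>i\<in>UNIV. \<bar>lam k $ i\<bar> *\<^sub>R \<xi> $ i)" for k
  proof -
    have "\<epsilon> k - grad f (x k) \<in>
        (\<Sum>i\<in>UNIV. set_scale \<bar>lam k $ i\<bar> (subdiff (sgn_comp (lam k $ i) F i) (x k)))"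
      using sub[of k] sumrule[of "lam k" "x k" 0] by (simp add: dir_subdiff_0)
    then obtain s where s: "\<epsilon> k - grad f (x k) = sum s UNIV"
        "\<And>i. s i \<in> set_scale \<bar>lam k $ i\<bar> (subdiff (sgn_comp (lam k $ i) F i) (x k))"
      by (auto simp: set_sum_alt)
    then obtain g where "\<And>i. g i \<in> subdiff (sgn_comp (lam k $ i) F i) (x k)"
        "\<And>i. s i = \<bar>lam k $ i\<bar> *\<^sub>R g i"
      unfolding set_scale_def image_iff by metis
    then show ?thesis
      using s(1) by (intro exI[of _ "\<chi> i. g i"]) simp
  qed
  then obtain \<xi> :: "nat \<Rightarrow> (real^'n)^'l" where
    \<xi>: "\<And>k i. \<xi> k $ i \<in> subdiff (sgn_comp (lam k $ i) F i) (x k)"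
      "\<And>k. \<epsilon> k - grad f (x k) = (\<Sum>i\<in>UNIV. \<bar>lam k $ i\<bar> *\<^sub>R \<xi> k $ i)"
    by metis
  obtain e L where e: "e > 0" "L-lipschitz_on (ball xbar e) F"
    using F(2) unfolding locally_lipschitz_def by blast
  have "\<forall>\<^sub>F k in sequentially. x k \<in> ball xbar e"
    using x e(1) by (intro topological_tendstoD) auto
  then obtain K where K: "\<And>k. k \<ge> K \<Longrightarrow> x k \<in> ball xbar e"
    by (auto simp: eventually_sequentially)
  \<comment> \<open>The floor 1 keeps \<open>inverse (m k)\<close> in \<open>(0, 1]\<close>: its
    limit is zero exactly if the multipliers blow up along the subsequence, and a positive limit
    allows the scaling to be undone.\<close>
  define m where "m k = max 1 (norm (lam k))" for k
  have m: "m k \<ge> 1" "m k \<ge> norm (lam k)" "m k > 0" for k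
    by (auto simp: m_def)
  \<comment> \<open>Sign vectors take finitely many values, so their convergence makes the signs
    eventually constant. The shift by \<open>K\<close> below puts every \<open>x\<close> into the
    ball where the Lipschitz bound holds.\<close>
  define sg where "sg k = (\<chi> i. sgn (lam k $ i))" for k
  define D where "D k = (\<xi> (k + K), lam (k + K) /\<^sub>R m (k + K), inverse (m (k + K)), sg (k + K))" for k
  have "norm (\<xi> (k + K)) \<le> (\<Sum>i\<in>(UNIV::'l set). L)" for k
  proof -
    have "norm (\<xi> (k + K)) \<le> (\<Sum>i\<in>UNIV. norm (\<xi> (k + K) $ i))"
      by (simp add: norm_vec_def L2_set_le_sum)
    also have "\<dots> \<le> (\<Sum>i\<in>(UNIV::'l set). L)"
      by (intro sum_mono subdiff_norm_le[OF open_ball K lipschitz_on_sgn_comp[OF e(2)] \<xi>(1)]) simp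
    finally show ?thesis .
  qed
  then have "bounded (range (\<lambda>k. \<xi> (k + K)))"
    by (intro boundedI[of _ "\<Sum>i\<in>(UNIV::'l set). L"]) auto
  moreover have "norm (lam (k + K) /\<^sub>R m (k + K)) \<le> 1" for k
    using m(2)[of "k + K"] m(3)[of "k + K"] by (simp add: field_simps)
  then have "bounded (range (\<lambda>k. lam (k + K) /\<^sub>R m (k + K)))"
    by (intro boundedI[of _ 1]) auto
  moreover have "norm (inverse (m (k + K))) \<le> 1" for k
    using m(1)[of "k + K"] m(3)[of "k + K"] by (simp add: field_simps)
  then have "bounded (range (\<lambda>k. inverse (m (k + K))))"
    by (intro boundedI[of _ 1]) auto
  moreover have "norm (sg (k + K)) \<le> (\<Sum>i\<in>(UNIV::'l set). 1)" for k
  proof -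
    have "norm (sg (k + K)) \<le> (\<Sum>i\<in>UNIV. norm (sg (k + K) $ i))"
      by (simp add: norm_vec_def L2_set_le_sum)
    also have "\<dots> \<le> (\<Sum>i\<in>(UNIV::'l set). 1)"
      by (intro sum_mono) (auto simp: sg_def sgn_if)
    finally show ?thesis .
  qed
  then have "bounded (range (\<lambda>k. sg (k + K)))"
    by (intro boundedI[of _ "\<Sum>i\<in>(UNIV::'l set). 1"]) auto
  ultimately have "bounded (range (\<lambda>k. \<xi> (k + K)) \<times> range (\<lambda>k. lam (k + K) /\<^sub>R m (k + K)) \<times>
      range (\<lambda>k. inverse (m (k + K))) \<times> range (\<lambda>k. sg (k + K)))"
    by (intro bounded_Times)
  then have "bounded (range D)"
    by (rule bounded_subset) (auto simp: D_def)
  then obtain l r where r: "strict_mono r" "(D \<circ> r) \<longlonglongrightarrow> l"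
    using bounded_imp_convergent_subsequence by blast
  obtain \<xi>0 u \<theta> s where l: "l = (\<xi>0, u, \<theta>, s)"
    by (metis surj_pair)
  have lim: "(\<lambda>k. \<xi> (r k + K)) \<longlonglongrightarrow> \<xi>0" "(\<lambda>k. lam (r k + K) /\<^sub>R m (r k + K)) \<longlonglongrightarrow> u"
    "(\<lambda>k. inverse (m (r k + K))) \<longlonglongrightarrow> \<theta>" "(\<lambda>k. sg (r k + K)) \<longlonglongrightarrow> s"
    using tendsto_fst[OF r(2)] tendsto_fst[OF tendsto_snd[OF r(2)]]
      tendsto_fst[OF tendsto_snd[OF tendsto_snd[OF r(2)]]]
      tendsto_snd[OF tendsto_snd[OF tendsto_snd[OF r(2)]]]
    by (simp_all add: l D_def)
  have "\<forall>\<^sub>F k in sequentially. dist (sg (r k + K)) s < 1/2"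
    by (rule tendstoD[OF lim(4)]) simp
  then obtain N where N: "\<And>k. k \<ge> N \<Longrightarrow> dist (sg (r k + K)) s < 1/2"
    by (auto simp: eventually_sequentially)
  \<comment> \<open>Discards the first \<open>N\<close> members, whose signs may still vary, and
    restores the shift by \<open>K\<close> built into \<open>D\<close>.\<close>
  define q where "q k = r (k + N) + K" for k
  have q: "strict_mono q"
    using r(1) by (auto simp: strict_mono_def q_def)
  have sgq: "sgn (lam (q k) $ i) = sgn (lam (q 0) $ i)" for k i
  proof -
    \<comment> \<open>Distinct signs differ by at least 1.\<close>
    have "dist (sg (q k)) (sg (q 0)) < 1"
      using dist_triangle_half_l[of "sg (q k)" s 1 "sg (q 0)"] N[of "k + N"] N[of N]
      by (simp add: q_def dist_commute)
    then have "\<bar>sgn (lam (q k) $ i) - sgn (lam (q 0) $ i)\<bar> < 1"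
      using dist_vec_nth_le[of "sg (q k)" i "sg (q 0)"] by (simp add: sg_def dist_real_def)
    then show ?thesis
      by (auto simp: sgn_if split: if_splits)
  qed
  \<comment> \<open>\<open>tail\<close> carries over limits known only along \<open>r\<close>,
    \<open>sub_q\<close> those of full sequences.\<close>
  have tail: "(\<lambda>k. g (q k)) \<longlonglongrightarrow> c" if "(\<lambda>k. g (r k + K)) \<longlonglongrightarrow> c"
    for g :: "nat \<Rightarrow> 'z::topological_space" and c
    using LIMSEQ_ignore_initial_segment[OF that, of N] by (simp add: q_def)
  have sub_q: "(\<lambda>k. g (q k)) \<longlonglongrightarrow> c" if "g \<longlonglongrightarrow> c"
    for g :: "nat \<Rightarrow> 'z::topological_space" and c
    using LIMSEQ_subseq_LIMSEQ[OF that q] by (simp add: o_def)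
  have \<tau>q: "(\<lambda>k. \<tau> (q k)) \<longlonglongrightarrow> 0" "\<And>k. \<tau> (q k) > 0"
    using sub_q[OF \<tau>(1)] \<tau>(2) by auto
  \<comment> \<open>With constant signs, all \<open>\<xi> (q k) $ i\<close> are subgradients of one
    and the same function.\<close>
  have \<xi>0: "\<xi>0 $ i \<in> dir_subdiff (sgn_comp (lam (q 0) $ i) F i) xbar d" for i
  proof (rule dir_subdiff_limit[OF _ _ \<tau>q])
    show "directionally_differentiable (sgn_comp (lam (q 0) $ i) F i)"
      by (rule directionally_differentiable_sgn_comp[OF F(1)])
    show "locally_lipschitz (sgn_comp (lam (q 0) $ i) F i)"
      using F(2) lipschitz_on_sgn_comp unfolding locally_lipschitz_def by metis
    show "(\<lambda>k. (x (q k) - xbar) /\<^sub>R \<tau> (q k)) \<longlonglongrightarrow> d"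
      using sub_q[OF x_dir] .
    show "(\<lambda>k. \<xi> (q k) $ i) \<longlonglongrightarrow> \<xi>0 $ i"
      by (intro tendsto_vec_nth tail lim)
    have "sgn_comp (lam (q k) $ i) F i = sgn_comp (lam (q 0) $ i) F i" for k
      by (simp add: sgn_comp_def sgq[of k])
    then show "\<xi> (q k) $ i \<in> subdiff (sgn_comp (lam (q 0) $ i) F i) (x (q k))" for k
      using \<xi>(1)[of "q k" i] by metis
  qed
  have grad: "(\<lambda>k. grad f (x k)) \<longlonglongrightarrow> grad f xbar"
    using f continuous_on_tendsto_compose[OF _ x, of UNIV "grad f"]
    by (simp add: cont_differentiable_def)
  have "(\<lambda>k. inverse (m (q k)) *\<^sub>R (\<epsilon> (q k) - grad f (x (q k)))) \<longlonglongrightarrow> \<theta> *\<^sub>R (0 - grad f xbar)"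
    by (intro tendsto_intros sub_q[OF \<epsilon>] sub_q[OF grad] tail lim)
  moreover have "inverse (m (q k)) *\<^sub>R (\<epsilon> (q k) - grad f (x (q k))) =
      (\<Sum>i\<in>UNIV. \<bar>(lam (q k) /\<^sub>R m (q k)) $ i\<bar> *\<^sub>R \<xi> (q k) $ i)" for k
    using m(3)[of "q k"] by (simp add: \<xi>(2) scaleR_sum_right abs_mult)
  moreover have "(\<lambda>k. \<Sum>i\<in>UNIV. \<bar>(lam (q k) /\<^sub>R m (q k)) $ i\<bar> *\<^sub>R \<xi> (q k) $ i)
      \<longlonglongrightarrow> (\<Sum>i\<in>UNIV. \<bar>u $ i\<bar> *\<^sub>R \<xi>0 $ i)"
    by (intro tendsto_intros tendsto_sum tail lim)
  ultimately have eq: "\<theta> *\<^sub>R (- grad f xbar) = (\<Sum>i\<in>UNIV. \<bar>u $ i\<bar> *\<^sub>R \<xi>0 $ i)"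
    using LIMSEQ_unique by auto
  \<comment> \<open>\<open>I\<close> is the active set of every iterate, hence it contains the
    support of every multiplier and of the limit \<open>u\<close>.\<close>
  have lam0: "lam k $ i = 0" if "i \<notin> I" for k i
    using normal_cone_odp_set_active[of "lam k" t a b F "x k" "\<delta> k" i] nor I that by blast
  have u0: "u $ i = 0" if "i \<notin> I" for i
    using tendsto_vec_nth[OF lim(2), of i] by (simp add: lam0[OF that] LIMSEQ_const_iff)
  \<comment> \<open>If \<open>\<theta> = 0\<close>, the gradient drops out of \<open>eq\<close>,
    leaving a vanishing combination with weights \<open>\<bar>u $ i\<bar>\<close>; since
    \<open>norm u = 1\<close>, this contradicts the qualification condition at index
    \<open>q 0\<close>.\<close>
  have "\<theta> > 0"
  proof (rule ccontr)
    assume "\<not> \<theta> > 0"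
    moreover have "\<theta> \<ge> 0"
      by (rule tendsto_lowerbound[OF lim(3)]) (auto simp: m(3) less_imp_le)
    ultimately have \<theta>: "\<theta> = 0" by simp
    \<comment> \<open>From here on the maximum in \<open>m\<close> is the norm, so the scaled
      multipliers have norm exactly 1.\<close>
    have "\<forall>\<^sub>F k in sequentially. inverse (m (r k + K)) < 1"
      using order_tendstoD(2)[OF lim(3), of 1] \<theta> by simp
    then have "\<forall>\<^sub>F k in sequentially. norm (lam (r k + K) /\<^sub>R m (r k + K)) = 1"
    proof eventually_elim
      case (elim k)
      then have "m (r k + K) = norm (lam (r k + K))"
        by (auto simp: m_def max_def split: if_splits)
      then show ?case
        using m(3)[of "r k + K"] by simp
    qed
    then have "(\<lambda>k. norm (lam (r k + K) /\<^sub>R m (r k + K))) \<longlonglongrightarrow> 1"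
      by (rule tendsto_eventually)
    then have "norm u = 1"
      using LIMSEQ_unique[OF tendsto_norm[OF lim(2)]] by blast
    then have "u \<noteq> 0" by auto
    then have "I \<noteq> {}"
      using u0 by (auto simp: vec_eq_iff)
    let ?u = "\<chi> i. \<bar>u $ i\<bar>"
    have "?u \<noteq> 0"
      using \<open>u \<noteq> 0\<close> by (auto simp: vec_eq_iff)
    moreover have "\<forall>i. ?u $ i \<ge> 0" "\<forall>i. i \<notin> I \<longrightarrow> ?u $ i = 0"
      using u0 by auto
    ultimately have "0 \<notin> (\<Sum>i\<in>I. set_scale (?u $ i) (dir_subdiff (sgn_comp (lam (q 0) $ i) F i) xbar d))"
      using cq \<open>I \<noteq> {}\<close> by blast
    moreover have "(\<Sum>i\<in>I. \<bar>u $ i\<bar> *\<^sub>R \<xi>0 $ i) = 0"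
      using eq \<theta> u0 sum.mono_neutral_left[of UNIV I "\<lambda>i. \<bar>u $ i\<bar> *\<^sub>R \<xi>0 $ i"] by simp
    then have "0 \<in> (\<Sum>i\<in>I. set_scale (?u $ i) (dir_subdiff (sgn_comp (lam (q 0) $ i) F i) xbar d))"
      using \<xi>0
      by (auto simp: set_sum_alt set_scale_def intro!: exI[of _ "\<lambda>i. \<bar>u $ i\<bar> *\<^sub>R \<xi>0 $ i"])
    ultimately show False by contradiction
  qed
  define mu where "mu = u /\<^sub>R \<theta>"
  have "(\<lambda>k. inverse (inverse (m (q k))) *\<^sub>R (lam (q k) /\<^sub>R m (q k))) \<longlonglongrightarrow> mu"
    unfolding mu_def using \<open>\<theta> > 0\<close> by (intro tendsto_intros tail lim) auto
  moreover have "inverse (inverse (m (q k))) *\<^sub>R (lam (q k) /\<^sub>R m (q k)) = lam (q k)" for k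
    using m(3)[of "q k"] by simp
  ultimately have lam_mu: "(\<lambda>k. lam (q k)) \<longlonglongrightarrow> mu"
    by simp
  \<comment> \<open>The normals live at \<open>F (x k) - \<delta> k\<close>; as
    \<open>\<delta>\<close> is negligible against \<open>\<tau>\<close>, these points approach in
    the same direction as \<open>F (x k)\<close>.\<close>
  have "(\<lambda>k. (F (x k) - F xbar) /\<^sub>R \<tau> k - \<delta> k /\<^sub>R \<tau> k) \<longlonglongrightarrow> dir_deriv F xbar d - 0"
    by (intro tendsto_diff \<delta>_dir difference_quotient_tendsto_dir_deriv F \<tau> x_dir)
  then have "(\<lambda>k. (F (x k) - \<delta> k - F xbar) /\<^sub>R \<tau> k) \<longlonglongrightarrow> dir_deriv F xbar d"
    by (simp add: algebra_simps)
  then have "mu \<in> dir_normal_cone (odp_set t a b) (F xbar) (dir_deriv F xbar d)"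
    using nor by (intro dir_normal_coneI[OF feas \<tau>q sub_q lam_mu])
  moreover have "- grad f xbar \<in> dir_subdiff (scalarize mu F) xbar d"
  proof -
    have "- grad f xbar = inverse \<theta> *\<^sub>R (\<theta> *\<^sub>R (- grad f xbar))"
      using \<open>\<theta> > 0\<close> by simp
    also have "\<dots> = (\<Sum>i\<in>UNIV. \<bar>mu $ i\<bar> *\<^sub>R \<xi>0 $ i)"
      unfolding eq using \<open>\<theta> > 0\<close> by (simp add: mu_def scaleR_sum_right abs_mult)
    finally have "- grad f xbar = (\<Sum>i\<in>UNIV. \<bar>mu $ i\<bar> *\<^sub>R \<xi>0 $ i)" .
    \<comment> \<open>If \<open>mu $ i = 0\<close>, the sign may have been lost in the limit, but
      then the product is 0 and only nonemptiness matters. Otherwise the constant sign along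
      \<open>q\<close> is that of \<open>mu $ i\<close>.\<close>
    moreover have "\<bar>mu $ i\<bar> *\<^sub>R \<xi>0 $ i
        \<in> set_scale \<bar>mu $ i\<bar> (dir_subdiff (sgn_comp (mu $ i) F i) xbar d)" for i
    proof (cases "mu $ i = 0")
      case True
      then show ?thesis
        using zero_in_dir_subdiff_zero[of xbar d] by (auto simp: set_scale_def sgn_comp_def)
    next
      case False
      have "(\<lambda>k. lam (q k) $ i * sgn (lam (q 0) $ i)) \<longlonglongrightarrow> mu $ i * sgn (lam (q 0) $ i)"
        by (intro tendsto_intros lam_mu)
      moreover have "lam (q k) $ i * sgn (lam (q 0) $ i) = \<bar>lam (q k) $ i\<bar>" for k
        using sgq[of k i] by (metis abs_sgn)
      ultimately have "\<bar>mu $ i\<bar> = mu $ i * sgn (lam (q 0) $ i)"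
        using LIMSEQ_unique[OF tendsto_rabs[OF tendsto_vec_nth[OF lam_mu]]] by simp
      then have "sgn (lam (q 0) $ i) = sgn (mu $ i)"
        using False by (auto simp: abs_if sgn_if split: if_splits)
      then show ?thesis
        using \<xi>0[of i] by (auto simp: set_scale_def sgn_comp_def)
    qed
    ultimately show ?thesis
      unfolding sumrule by (auto simp: set_sum_alt)
  qed
  ultimately show ?thesis by blast
qed

section \<open>Choice of direction and step sizes for the two claims\<close>

theorem theorem4p6:
  fixes f :: "real ^ 'n \<Rightarrow> real"
    and F :: "real ^ 'n \<Rightarrow> real ^ 'l"
    and t :: nat
    and a b :: "nat \<Rightarrow> 'l \<Rightarrow> ereal"
    and xbar :: "real ^ 'n"
  assumes "\<And>i j. j \<in> {1..t} \<Longrightarrow> a j i \<le> b j i"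
    and "cont_differentiable f"
    and "directionally_differentiable F"
    and "locally_lipschitz F"
    and "\<forall>(x :: real ^ 'n) (d :: real ^ 'n) (lam :: real ^ 'l).
           dir_subdiff (scalarize lam F) x d =
             (\<Sum>i\<in>UNIV. set_scale \<bar>lam $ i\<bar> (dir_subdiff (sgn_comp (lam $ i) F i) x d))"
    and "AM_stationary f F (odp_set t a b) xbar"
  shows "(ODP_subMFC f F t a b xbar \<longrightarrow> M_stationary f F (odp_set t a b) xbar) \<and>
         (\<forall>d \<in> critical_cone f F (odp_set t a b) xbar \<inter> sphere 0 1.
            ODP_subMFC_dir f F t a b xbar d \<longrightarrow> M_stationary_dir f F (odp_set t a b) xbar d)"
proof (intro conjI impI ballI)
  note multiplier = multiplier_of_subMFC[OF assms(2,3,4) assms(5)[rule_format]]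
  show "M_stationary f F (odp_set t a b) xbar" if mfc: "ODP_subMFC f F t a b xbar"
  proof -
    from mfc obtain I x lam \<delta> \<epsilon> where
      cq: "I = {} \<or>
         (\<forall>u::real^'l. u \<noteq> 0 \<and> (\<forall>i. u $ i \<ge> 0) \<and> (\<forall>i. i \<notin> I \<longrightarrow> u $ i = 0) \<longrightarrow>
            (\<forall>k. 0 \<notin> (\<Sum>i\<in>I. set_scale (u $ i) (subdiff (sgn_comp (lam k $ i) F i) xbar))))"
      and AM: "AM_sequence f F (odp_set t a b) xbar x lam \<delta> \<epsilon>"
      and I: "\<And>k. I = active_indices F t a b (x k) (\<delta> k)"
      unfolding ODP_subMFC_def by blast
    have lims: "x \<longlonglongrightarrow> xbar" "\<delta> \<longlonglongrightarrow> 0" and feas: "F xbar \<in> odp_set t a b"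
      using AM by (auto simp: AM_sequence_def)
    \<comment> \<open>The distance \<open>norm (x k - xbar)\<close> may be zero or fail to dominate
      \<open>\<delta> k\<close>; a step size for the pair handles both components.\<close>
    have "(\<lambda>k. (x k - xbar, \<delta> k)) \<longlonglongrightarrow> 0"
      unfolding zero_prod_def by (intro tendsto_Pair LIM_zero lims)
    then obtain \<tau> where \<tau>: "\<tau> \<longlonglongrightarrow> 0" "\<And>k. \<tau> k > 0"
        and lim: "(\<lambda>k. (x k - xbar, \<delta> k) /\<^sub>R \<tau> k) \<longlonglongrightarrow> 0"
      using ex_step_size by blast
    have "(\<lambda>k. (x k - xbar) /\<^sub>R \<tau> k) \<longlonglongrightarrow> 0" "(\<lambda>k. \<delta> k /\<^sub>R \<tau> k) \<longlonglongrightarrow> 0"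
      using tendsto_fst[OF lim] tendsto_snd[OF lim] by simp_all
    with multiplier[OF AM I cq[folded dir_subdiff_0] \<tau>] feas show ?thesis
      by (auto simp: M_stationary_def dir_subdiff_0 dir_deriv_0 dir_normal_cone_0)
  qed
  show "M_stationary_dir f F (odp_set t a b) xbar d"
    if d: "d \<in> critical_cone f F (odp_set t a b) xbar \<inter> sphere 0 1"
      and mfc: "ODP_subMFC_dir f F t a b xbar d" for d
  proof -
    from mfc obtain I x lam \<delta> \<epsilon> where
      cq: "I = {} \<or>
         (\<forall>u::real^'l. u \<noteq> 0 \<and> (\<forall>i. u $ i \<ge> 0) \<and> (\<forall>i. i \<notin> I \<longrightarrow> u $ i = 0) \<longrightarrow>
            (\<forall>k. 0 \<notin> (\<Sum>i\<in>I. set_scale (u $ i) (dir_subdiff (sgn_comp (lam k $ i) F i) xbar d))))"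
      and AMd: "AM_sequence_dir f F (odp_set t a b) xbar d x lam \<delta> \<epsilon>"
      and I: "\<And>k. I = active_indices F t a b (x k) (\<delta> k)"
      unfolding ODP_subMFC_dir_def by blast
    \<comment> \<open>Here the distances to \<open>xbar\<close> serve as step sizes; they are
      positive since \<open>x k\<close> differs from \<open>xbar\<close>.\<close>
    from AMd have AM: "AM_sequence f F (odp_set t a b) xbar x lam \<delta> \<epsilon>"
      and ne: "\<And>k. norm (x k - xbar) > 0"
      and lims: "(\<lambda>k. (x k - xbar) /\<^sub>R norm (x k - xbar)) \<longlonglongrightarrow> d"
        "(\<lambda>k. \<delta> k /\<^sub>R norm (x k - xbar)) \<longlonglongrightarrow> 0"
      by (auto simp: AM_sequence_dir_def)
    have "x \<longlonglongrightarrow> xbar" and feas: "F xbar \<in> odp_set t a b"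
      using AM by (auto simp: AM_sequence_def)
    then have "(\<lambda>k. norm (x k - xbar)) \<longlonglongrightarrow> 0"
      by (intro tendsto_norm_zero LIM_zero)
    from multiplier[OF AM I cq this ne lims] d feas show ?thesis
      by (auto simp: M_stationary_dir_def)
  qed
qed

end
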